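(* In the following, families $\mathcal{G}=\{G_1,\ldots,G_k\}$ consist of $k\ge 2$ connected graphs on a common vertex set $V$ with $|V|\ge 3$ (where $k$ and $V$ may depend on $N$). (a) For every real number $N$ there exists a family $\mathcal{G}$ with $\mathrm{Sd}_f(\mathcal{G})-\max_{1\le i\le k}\{\dim_f(G_i)\}\ge N$. (b) For every real number $N$ there exists a family $\mathcal{G}$ with $\min\left\{\sum_{i=1}^{k}\dim_f(G_i),\frac{|V|}{2}\right\}-\mathrm{Sd}_f(\mathcal{G})\ge N$. (c) For every real number $N$ there exists a family $\mathcal{G}$ with $\mathrm{Sd}(\mathcal{G})-\mathrm{Sd}_f(\mathcal{G})\ge N$.
   Context: Graphs are finite, simple and undirected. $d_G(x,y)$ is the least number of edges on a path joining $x$ and $y$ in $G$ ($\infty$ if there is none). For distinct $x,y\in V(G)$, $R_G\{x,y\}=\{z\in V(G): d_G(x,z)\ne d_G(y,z)\}$. For a function $g$ on $V$ and $U\subseteq V$, $g(U)=\sum_{s\in U}g(s)$. A resolving function of $G$ is a function $g:V(G)\to[0,1]$ with $g(R_G\{x,y\})\ge 1$ for all distinct $x,y\in V(G)$; the fractional dimension $\dim_f(G)$ is the minimum of $g(V(G))$ over all resolving functions $g$ of $G$. For a family $\mathcal{G}$ of graphs on a common vertex set $V$, a simultaneous resolving function is a function $g:V\to[0,1]$ that is a resolving function of every member of $\mathcal{G}$, and the simultaneous fractional dimension $\mathrm{Sd}_f(\mathcal{G})$ is the minimum of $g(V)$ over all simultaneous resolving functions $g$ of $\mathcal{G}$. A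 set $S\subseteq V(G)$ is a resolving set of $G$ if $S\cap R_G\{x,y\}\neq\emptyset$ for all distinct $x,y\in V(G)$; the simultaneous dimension $\mathrm{Sd}(\mathcal{G})$ is the minimum cardinality of a set $S\subseteq V$ that is a resolving set of every member of $\mathcal{G}$. *)

theory Defs
  imports
    "HOL-Analysis.Analysis"
    "HOL-Library.Extended_Nat"
    "Graph_Theory.Graph_Theory"
begin

text \<open>
  A finite simple undirected graph is a \<^term>\<open>pair_graph\<close>: a finite digraph without loops or
  parallel arcs whose arc relation is symmetric.  An edge is a pair of opposite arcs, so the number
  of arcs of a path equals its number of edges.
\<close>

definition gdist :: "'a pair_pre_digraph \<Rightarrow> 'a \<Rightarrow> 'a \<Rightarrow> enat" where
  "gdist G x y = (INF p \<in> {p. pre_digraph.apath (with_proj G) x p y}. enat (length p))"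

definition resolving_nbhd :: "'a pair_pre_digraph \<Rightarrow> 'a \<Rightarrow> 'a \<Rightarrow> 'a set" where
  "resolving_nbhd G x y = {z \<in> pverts G. gdist G x z \<noteq> gdist G y z}"

text \<open>
  A function on \<open>V\<close> is represented by a total function of which only the values on \<open>V\<close> matter.
\<close>

definition resolving_function :: "'a pair_pre_digraph \<Rightarrow> ('a \<Rightarrow> real) \<Rightarrow> bool" where
  "resolving_function G g \<longleftrightarrow>
     (\<forall>v \<in> pverts G. g v \<in> {0..1}) \<and>
     (\<forall>x \<in> pverts G. \<forall>y \<in> pverts G. x \<noteq> y \<longrightarrow> sum g (resolving_nbhd G x y) \<ge> 1)"

definition sim_resolving_function ::
    "'a set \<Rightarrow> 'a pair_pre_digraph set \<Rightarrow> ('a \<Rightarrow> real) \<Rightarrow> bool" where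
  "sim_resolving_function V \<G> g \<longleftrightarrow>
     (\<forall>v \<in> V. g v \<in> {0..1}) \<and> (\<forall>G \<in> \<G>. resolving_function G g)"

text \<open>
  The minima below are written as infima; \<open>dim_f_minimum\<close> and \<open>Sd_f_minimum\<close> show that they are
  attained.
\<close>

definition dim_f :: "'a pair_pre_digraph \<Rightarrow> real" where
  "dim_f G = Inf {sum g (pverts G) | g. resolving_function G g}"

definition Sd_f :: "'a set \<Rightarrow> 'a pair_pre_digraph set \<Rightarrow> real" where
  "Sd_f V \<G> = Inf {sum g V | g. sim_resolving_function V \<G> g}"

definition resolving_set :: "'a pair_pre_digraph \<Rightarrow> 'a set \<Rightarrow> bool" where
  "resolving_set G S \<longleftrightarrow> S \<subseteq> pverts G \<and>
     (\<forall>x \<in> pverts G. \<forall>y \<in> pverts G. x \<noteq> y \<longrightarrow> S \<inter> resolving_nbhd G x y \<noteq> {})"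

definition Sd :: "'a set \<Rightarrow> 'a pair_pre_digraph set \<Rightarrow> nat" where
  "Sd V \<G> = Min (card ` {S. S \<subseteq> V \<and> (\<forall>G \<in> \<G>. resolving_set G S)})"

text \<open>
  A family is a set, so its \<open>k = card \<G>\<close> members are pairwise distinct as graphs on \<open>V\<close>
  (isomorphic members are allowed).  \<open>connected\<close> must be qualified: the bare name is topological
  connectedness.
\<close>

definition graph_family :: "'a set \<Rightarrow> 'a pair_pre_digraph set \<Rightarrow> bool" where
  "graph_family V \<G> \<longleftrightarrow>
     finite V \<and> card V \<ge> 3 \<and> finite \<G> \<and> card \<G> \<ge> 2 \<and>
     (\<forall>G \<in> \<G>. pair_graph G \<and> pverts G = V \<and> Digraph_Component.connected (with_proj G))"

lemma gdist_refl:
  assumes "x \<in> pverts G"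
  shows "gdist G x x = 0"
proof -
  have "pre_digraph.apath (with_proj G) x [] x"
    using assms
    by (simp add: pre_digraph.apath_def pre_digraph.awalk_def pre_digraph.cas.simps
        pre_digraph.awalk_verts.simps)
  then have "gdist G x x \<le> enat (length ([] :: ('a \<times> 'a) list))"
    unfolding gdist_def by (intro INF_lower) simp
  then show ?thesis
    by (simp flip: zero_enat_def)
qed

lemma gdist_neq:
  assumes "x \<noteq> y"
  shows "gdist G x y \<noteq> 0"
proof -
  have "1 \<le> enat (length p)" if "pre_digraph.apath (with_proj G) x p y" for p
    using that assms
    by (cases p)
      (auto simp: pre_digraph.apath_def pre_digraph.awalk_def pre_digraph.cas.simps one_enat_def)
  then have "1 \<le> gdist G x y"
    unfolding gdist_def by (intro INF_greatest) simp
  then show ?thesis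
    by auto
qed

lemma mem_resolving_nbhd:
  assumes "x \<in> pverts G" "x \<noteq> y"
  shows "x \<in> resolving_nbhd G x y"
  using gdist_refl[OF assms(1)] gdist_neq[of y x G] assms by (simp add: resolving_nbhd_def)

lemma resolving_function_one:
  assumes "finite (pverts G)"
  shows "resolving_function G (\<lambda>_. 1)"
proof -
  have "1 \<le> card (resolving_nbhd G x y)" if "x \<in> pverts G" "x \<noteq> y" for x y
  proof -
    have "finite (resolving_nbhd G x y)"
      using assms by (simp add: resolving_nbhd_def)
    then show ?thesis
      using mem_resolving_nbhd[OF that] by (metis One_nat_def Suc_leI card_gt_0_iff empty_iff)
  qed
  then show ?thesis
    by (force simp: resolving_function_def)
qed

lemma sum_minimum_attained:
  fixes V :: "'a set" and \<U> :: "'a set set"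
  defines "A \<equiv> {g :: 'a \<Rightarrow> real. (\<forall>v \<in> V. g v \<in> {0..1}) \<and> (\<forall>U \<in> \<U>. 1 \<le> sum g U)}"
  assumes "finite V" "\<And>U. U \<in> \<U> \<Longrightarrow> U \<subseteq> V" "A \<noteq> {}"
  shows "\<exists>g \<in> A. \<forall>h \<in> A. sum g V \<le> sum h V"
proof -
  define r where "r g = (\<lambda>v. if v \<in> V then g v else 0)" for g :: "'a \<Rightarrow> real"
  have r_sum: "sum (r g) U = sum g U" if "U \<subseteq> V" for g U
    using that by (intro sum.cong) (auto simp: r_def)
  have r_A: "r g \<in> A" if "g \<in> A" for g
    using that assms(3) by (auto simp: A_def r_sum) (auto simp: r_def)
  define B where "B = (\<Pi>\<^sub>E v\<in>UNIV. if v \<in> V then {0..1::real} else {0})"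
  have "compactin (product_topology (\<lambda>_. euclidean) UNIV) B"
    unfolding B_def by (subst compactin_PiE) auto
  then have "compact B"
    by (metis compactin_euclidean_iff euclidean_product_topology)
  moreover have "closed {g :: 'a \<Rightarrow> real. 1 \<le> sum g U}" for U
    by (intro closed_Collect_le continuous_intros)
       (auto intro: continuous_on_product_coordinates)
  then have "closed (\<Inter>U\<in>\<U>. {g :: 'a \<Rightarrow> real. 1 \<le> sum g U})"
    by blast
  ultimately have compact: "compact (B \<inter> (\<Inter>U\<in>\<U>. {g. 1 \<le> sum g U}))"
    by (rule compact_Int_closed)
  have eq: "B \<inter> (\<Inter>U\<in>\<U>. {g. 1 \<le> sum g U}) = r ` A"
  proof (intro equalityI subsetI)
    fix g assume g: "g \<in> B \<inter> (\<Inter>U\<in>\<U>. {g. 1 \<le> sum g U})"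
    then have *: "g v \<in> (if v \<in> V then {0..1} else {0})" for v
      by (auto simp: B_def PiE_iff)
    have "g v \<in> {0..1}" if "v \<in> V" for v
      using *[of v] that by simp
    with g have "g \<in> A"
      by (simp add: A_def)
    moreover have "g = r g"
    proof
      show "g v = r g v" for v
        using *[of v] by (simp add: r_def split: if_splits)
    qed
    ultimately show "g \<in> r ` A"
      by blast
  next
    fix g assume "g \<in> r ` A"
    then obtain h where h: "h \<in> A" "g = r h" by blast
    have "r h \<in> B"
      using h by (auto simp: B_def r_def A_def)
    then show "g \<in> B \<inter> (\<Inter>U\<in>\<U>. {g. 1 \<le> sum g U})"
      using r_A[OF h(1)] h(2) by (simp add: A_def)
  qed
  have "compact (r ` A)"
    using compact unfolding eq .
  moreover have "continuous_on (r ` A) (\<lambda>g. sum g V)"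
    by (intro continuous_intros)
       (auto intro: continuous_on_subset[OF continuous_on_product_coordinates])
  ultimately obtain g where g: "g \<in> r ` A" "\<And>h. h \<in> r ` A \<Longrightarrow> sum g V \<le> sum h V"
    using continuous_attains_inf[of "r ` A" "\<lambda>g. sum g V"] assms(4) by (metis image_is_empty)
  have "g \<in> A"
    using g(1) r_A by blast
  moreover have "sum g V \<le> sum h V" if "h \<in> A" for h
    using g(2)[of "r h"] that r_sum[of V h] by simp
  ultimately show ?thesis
    by (intro bexI[of _ g] ballI)
qed

lemma Sd_f_minimum:
  assumes "finite V" "\<And>G. G \<in> \<G> \<Longrightarrow> pverts G = V"
  shows "\<exists>g. sim_resolving_function V \<G> g \<and> sum g V = Sd_f V \<G>"
    and "sim_resolving_function V \<G> h \<Longrightarrow> Sd_f V \<G> \<le> sum h V"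
proof -
  define \<U> where
    "\<U> = {resolving_nbhd G x y | G x y. G \<in> \<G> \<and> x \<in> V \<and> y \<in> V \<and> x \<noteq> y}"
  have ball_\<U>: "(\<forall>U \<in> \<U>. P U) \<longleftrightarrow>
      (\<forall>G \<in> \<G>. \<forall>x \<in> V. \<forall>y \<in> V. x \<noteq> y \<longrightarrow> P (resolving_nbhd G x y))" for P
    unfolding \<U>_def by blast
  have iff: "sim_resolving_function V \<G> g \<longleftrightarrow>
      (\<forall>v \<in> V. g v \<in> {0..1}) \<and> (\<forall>U \<in> \<U>. 1 \<le> sum g U)" for g
    unfolding sim_resolving_function_def resolving_function_def ball_\<U>
    by (simp add: assms(2) ball_conj_distrib cong: ball_cong) argo
  have "sim_resolving_function V \<G> (\<lambda>_. 1)"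
    using assms resolving_function_one by (auto simp: sim_resolving_function_def)
  then have "(\<lambda>_. 1) \<in> {g :: 'a \<Rightarrow> real. (\<forall>v \<in> V. g v \<in> {0..1}) \<and> (\<forall>U \<in> \<U>. 1 \<le> sum g U)}"
    unfolding iff by simp
  then have ne: "{g :: 'a \<Rightarrow> real. (\<forall>v \<in> V. g v \<in> {0..1}) \<and> (\<forall>U \<in> \<U>. 1 \<le> sum g U)} \<noteq> {}"
    by (rule contrapos_pn) (rule equals0D)
  have sub: "U \<subseteq> V" if "U \<in> \<U>" for U
    using that assms(2) by (auto simp: \<U>_def resolving_nbhd_def)
  have "\<exists>g \<in> {g. sim_resolving_function V \<G> g}.
      \<forall>h \<in> {g. sim_resolving_function V \<G> g}. sum g V \<le> sum h V"
    unfolding iff using sum_minimum_attained[OF assms(1) sub ne] .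
  then obtain g where g: "sim_resolving_function V \<G> g"
      "\<And>h. sim_resolving_function V \<G> h \<Longrightarrow> sum g V \<le> sum h V"
    by blast
  then have Sd_f: "Sd_f V \<G> = sum g V"
    unfolding Sd_f_def by (intro cInf_eq_minimum) auto
  from g(1) show "\<exists>g. sim_resolving_function V \<G> g \<and> sum g V = Sd_f V \<G>"
    unfolding Sd_f by (intro exI[of _ g] conjI refl)
  show "sim_resolving_function V \<G> h \<Longrightarrow> Sd_f V \<G> \<le> sum h V"
    unfolding Sd_f by (rule g(2))
qed

lemma sim_resolving_function_singleton:
  "sim_resolving_function (pverts G) {G} g \<longleftrightarrow> resolving_function G g"
  by (auto simp: sim_resolving_function_def resolving_function_def)

lemma dim_f_eq_Sd_f: "dim_f G = Sd_f (pverts G) {G}"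
  by (simp only: dim_f_def Sd_f_def sim_resolving_function_singleton)

lemma dim_f_minimum:
  assumes "finite (pverts G)"
  shows "\<exists>g. resolving_function G g \<and> sum g (pverts G) = dim_f G"
    and "resolving_function G h \<Longrightarrow> dim_f G \<le> sum h (pverts G)"
proof -
  have *: "pverts H = pverts G" if "H \<in> {G}" for H
    using that by simp
  show "\<exists>g. resolving_function G g \<and> sum g (pverts G) = dim_f G"
    using Sd_f_minimum(1)[where \<G> = "{G}", OF assms *]
    by (simp only: dim_f_eq_Sd_f sim_resolving_function_singleton)
  show "resolving_function G h \<Longrightarrow> dim_f G \<le> sum h (pverts G)"
    using Sd_f_minimum(2)[where \<G> = "{G}", OF assms *]
    by (simp only: dim_f_eq_Sd_f sim_resolving_function_singleton)
qed

end

theory Submission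
  imports Defs
begin

text \<open>
  All graphs used here have a vertex \<open>0\<close> adjacent to every other vertex.  Their distances are at
  most \<open>2\<close>, so \<open>z\<close> resolves \<open>x\<close> and \<open>y\<close> exactly when \<open>z\<close> is \<open>x\<close> or \<open>y\<close> or is adjacent to just
  one of them (\<open>mem_resolving_nbhd_cone\<close>).

  Parts (a) and (b) rest on one construction.  The vertices \<open>1, \<dots>, 4m\<close> are split by parity into
  two sides of \<open>2m\<close> vertices.  One side \<open>A\<close> consists of \<open>m\<close> pairs of twins; each pair must receive
  total weight at least \<open>1\<close>, so the fractional dimension is at least \<open>m\<close> (\<open>twins_weight\<close>).  A vertex
  of the other side \<open>B\<close> is joined to both or to neither member of each pair of \<open>A\<close>, according to its
  binary digits.  For large \<open>m\<close>, \<open>m\<close> digits are enough to tell the vertices apart, so the weight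
  \<open>1/2\<close> on \<open>A\<close> and \<open>1\<close> on \<open>0\<close> resolves everything (\<open>resolving_side_weight\<close>), and the fractional dimension is at
  most \<open>m + 1\<close>.

  For (a), take the two graphs in which the two sides exchange their roles: now both sides consist of
  pairs that need weight \<open>1\<close>, so \<open>Sd_f\<close> is at least \<open>2m\<close>.  For (b), keep the side \<open>A\<close> and take two
  graphs that differ only in whether \<open>B\<close> is a clique: the weight on \<open>A\<close> serves both, so \<open>Sd_f\<close> is at
  most \<open>m + 1\<close>, whereas the dimensions add up to at least \<open>2m\<close> and there are more than \<open>4m\<close>
  vertices.

  For (c), a family that contains the complete graph has \<open>Sd\<close> at least \<open>card V - 1\<close>, while the
  constant \<open>1/2\<close> is a resolving function of every graph.
\<close>

section \<open>Graphs with a dominating vertex\<close>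

definition cone_graph :: "nat \<Rightarrow> (nat \<Rightarrow> nat \<Rightarrow> bool) \<Rightarrow> nat pair_pre_digraph" where
  "cone_graph n E = \<lparr>pverts = {..n},
     parcs = {(x, y). x \<le> n \<and> y \<le> n \<and> x \<noteq> y \<and> (x = 0 \<or> y = 0 \<or> E x y \<or> E y x)}\<rparr>"

lemma pverts_cone [simp]: "pverts (cone_graph n E) = {..n}"
  by (simp add: cone_graph_def)

lemma parcs_cone:
  "(x, y) \<in> parcs (cone_graph n E) \<longleftrightarrow>
     x \<le> n \<and> y \<le> n \<and> x \<noteq> y \<and> (x = 0 \<or> y = 0 \<or> E x y \<or> E y x)"
  by (simp add: cone_graph_def)

lemma pair_graph_cone: "pair_graph (cone_graph n E)"
proof
  have "parcs (cone_graph n E) \<subseteq> {..n} \<times> {..n}"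
    by (auto simp: parcs_cone)
  then show "finite (parcs (cone_graph n E))"
    by (rule finite_subset) simp
  show "symmetric (with_proj (cone_graph n E))"
    by (auto simp: symmetric_def sym_def parcs_cone)
qed (auto simp: parcs_cone)

lemma connected_cone: "Digraph_Component.connected (with_proj (cone_graph n E))"
proof -
  interpret pair_graph "cone_graph n E"
    by (rule pair_graph_cone)
  have to_0: "x \<rightarrow>\<^sup>*\<^bsub>with_proj (cone_graph n E)\<^esub> 0" and from_0: "0 \<rightarrow>\<^sup>*\<^bsub>with_proj (cone_graph n E)\<^esub> x"
    if "x \<le> n" for x
    using that by (cases "x = 0"; auto simp: parcs_cone intro!: reachable_adjI)+
  have "x \<rightarrow>\<^sup>*\<^bsub>with_proj (cone_graph n E)\<^esub> y" if "x \<le> n" "y \<le> n" for x y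
    using to_0[OF that(1)] from_0[OF that(2)] by (rule reachable_trans)
  then have "strongly_connected (with_proj (cone_graph n E))"
    by (intro strongly_connectedI) auto
  moreover have "symmetric (with_proj (cone_graph n E))"
    by (rule sym_arcs)
  ultimately show ?thesis
    unfolding Digraph_Component.connected_def strongly_connected_def
    by (simp add: reachable_mk_symmetric_eq)
qed

lemma gdist_cone:
  assumes "x \<le> n" "z \<le> n"
  shows "gdist (cone_graph n E) x z =
    (if x = z then 0 else if (x, z) \<in> parcs (cone_graph n E) then 1 else 2)"
proof -
  interpret pair_graph "cone_graph n E"
    by (rule pair_graph_cone)
  have upper: "gdist (cone_graph n E) x z \<le> enat (length p)" if "apath x p z" for p
    unfolding gdist_def using that by (intro INF_lower) simp
  show ?thesis
  proof (cases "x = z")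
    case True
    then show ?thesis
      using assms by (simp add: gdist_refl)
  next
    case False
    show ?thesis
    proof (cases "(x, z) \<in> parcs (cone_graph n E)")
      case True
      then have "apath x [(x, z)] z"
        using assms \<open>x \<noteq> z\<close> by (simp add: apath_def awalk_def)
      then have "gdist (cone_graph n E) x z \<le> 1"
        using upper[of "[(x, z)]"] by (simp add: one_enat_def)
      moreover have "gdist (cone_graph n E) x z \<ge> 1"
        using gdist_neq[OF \<open>x \<noteq> z\<close>] by (simp add: Suc_ile_eq one_enat_def flip: zero_enat_def)
      ultimately show ?thesis
        using True \<open>x \<noteq> z\<close> by simp
    next
      case no_arc: False
      have "2 \<le> enat (length p)" if "apath x p z" for p
      proof (rule ccontr)
        assume "\<not> ?thesis"
        then have "length p < 2"
          by (simp add: numeral_eq_enat)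
        then consider "p = []" | a where "p = [a]"
          by (cases p) (auto simp: less_Suc_eq numeral_2_eq_2)
        then show False
          using that no_arc \<open>x \<noteq> z\<close> by cases (auto simp: apath_def awalk_def)
      qed
      then have "gdist (cone_graph n E) x z \<ge> 2"
        unfolding gdist_def by (intro INF_greatest) simp
      moreover have "apath x [(x, 0), (0, z)] z"
        using assms \<open>x \<noteq> z\<close> no_arc by (auto simp: apath_def awalk_def parcs_cone)
      then have "gdist (cone_graph n E) x z \<le> 2"
        using upper[of "[(x, 0), (0, z)]"] by (simp add: numeral_eq_enat numeral_2_eq_2)
      ultimately show ?thesis
        using no_arc \<open>x \<noteq> z\<close> by simp
    qed
  qed
qed

lemma mem_resolving_nbhd_cone:
  assumes "x \<le> n" "y \<le> n" "x \<noteq> y"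
  shows "z \<in> resolving_nbhd (cone_graph n E) x y \<longleftrightarrow> z \<le> n \<and>
    (z = x \<or> z = y \<or> ((x, z) \<in> parcs (cone_graph n E) \<longleftrightarrow> (y, z) \<notin> parcs (cone_graph n E)))"
  using assms by (auto simp: resolving_nbhd_def gdist_cone parcs_cone one_enat_def zero_enat_def numeral_eq_enat
      split: if_splits)

lemma graph_family_cones:
  assumes "finite \<G>" "card \<G> \<ge> 2" "\<And>G. G \<in> \<G> \<Longrightarrow> \<exists>E. G = cone_graph n E" "n \<ge> 2"
  shows "graph_family {..n} \<G>"
  using assms pair_graph_cone connected_cone by (fastforce simp: graph_family_def)

section \<open>Twin pairs on one side, binary codes on the other\<close>

text \<open>
  For a vertex \<open>x \<noteq> 0\<close> of parity \<open>e\<close>, the index of its twin pair is \<open>(x - 1) div 4\<close>.  The number of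
  a vertex of the other side serves as its code.
\<close>

definition coded :: "nat \<Rightarrow> bool \<Rightarrow> bool \<Rightarrow> nat pair_pre_digraph" where
  "coded m e clique = cone_graph (4 * m) (\<lambda>x y.
     if even x = e then even y = e \<or> bit y ((x - 1) div 4) else clique \<and> even y \<noteq> e)"

text \<open>
  Each block \<open>4c + 1, \<dots>, 4c + 4\<close> contains one pair of either side, so the partition into pairs is
  the same for both choices of \<open>e\<close>; only one side's pairs are twins in a given graph.
\<close>

definition twin :: "bool \<Rightarrow> nat \<Rightarrow> nat" where
  "twin e c = 4 * c + (if e then 2 else 1)"

definition twin' :: "bool \<Rightarrow> nat \<Rightarrow> nat" where
  "twin' e c = 4 * c + (if e then 4 else 3)"

lemma twin_simps [simp]:
  "even (twin e c) = e" "even (twin' e c) = e" "twin e c \<noteq> 0" "twin' e c \<noteq> 0"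
  "(twin e c - Suc 0) div 4 = c" "(twin' e c - Suc 0) div 4 = c"
  "twin e c \<noteq> twin' e c" "twin' e c \<noteq> twin e c"
  by (auto simp: twin_def twin'_def)

lemma twin_le: "c < m \<Longrightarrow> twin e c \<le> 4 * m" "c < m \<Longrightarrow> twin' e c \<le> 4 * m"
  by (auto simp: twin_def twin'_def)

lemma pverts_coded [simp]: "pverts (coded m e clique) = {..4 * m}"
  by (simp add: coded_def)

lemma arc_coded:
  assumes "x \<le> 4 * m" "z \<le> 4 * m" "even x = e"
  shows "(x, z) \<in> parcs (coded m e clique) \<longleftrightarrow>
    x \<noteq> z \<and> (x = 0 \<or> z = 0 \<or> even z = e \<or> bit z ((x - 1) div 4))"
    and "(z, x) \<in> parcs (coded m e clique) \<longleftrightarrow>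
    x \<noteq> z \<and> (x = 0 \<or> z = 0 \<or> even z = e \<or> bit z ((x - 1) div 4))"
  using assms by (auto simp: coded_def parcs_cone)

lemma mem_resolving_nbhd_coded:
  assumes "x \<le> 4 * m" "y \<le> 4 * m" "x \<noteq> y"
  shows "z \<in> resolving_nbhd (coded m e clique) x y \<longleftrightarrow> z \<le> 4 * m \<and>
    (z = x \<or> z = y \<or>
      ((x, z) \<in> parcs (coded m e clique) \<longleftrightarrow> (y, z) \<notin> parcs (coded m e clique)))"
  using assms by (simp add: coded_def mem_resolving_nbhd_cone)

text \<open>
  The two members of a pair have the same clique neighbours and the same index, hence the same
  neighbours on the coded side; only the pair itself can resolve them.
\<close>

lemma resolving_nbhd_twins:
  assumes "c < m"
  shows "resolving_nbhd (coded m e clique) (twin e c) (twin' e c) = {twin e c, twin' e c}"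
  using twin_le[OF assms, of e]
  by (auto simp: mem_resolving_nbhd_coded) (auto simp: arc_coded)

lemma twins_weight:
  assumes "resolving_function (coded m e clique) g" "c < m"
  shows "1 \<le> g (twin e c) + g (twin' e c)"
proof -
  have "1 \<le> sum g (resolving_nbhd (coded m e clique) (twin e c) (twin' e c))"
    using assms twin_le[OF assms(2), of e] by (auto simp: resolving_function_def)
  then show ?thesis
    by (simp add: resolving_nbhd_twins[OF assms(2)])
qed

lemma sum_twins:
  fixes g :: "nat \<Rightarrow> real"
  shows "sum g {..4 * m} =
    g 0 + (\<Sum>c<m. g (twin e c) + g (twin' e c)) +
    (\<Sum>c<m. g (twin (\<not> e) c) + g (twin' (\<not> e) c))"
proof (induction m)
  case (Suc m)
  have "{..4 * Suc m} = {..4 * m} \<union> {4 * m + 1, 4 * m + 2, 4 * m + 3, 4 * m + 4}"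
    by auto
  then have "sum g {..4 * Suc m} =
      sum g {..4 * m} + (g (4 * m + 1) + g (4 * m + 2) + g (4 * m + 3) + g (4 * m + 4))"
    by (simp add: sum.union_disjoint)
  then show ?case
    using Suc by (cases e) (simp_all add: twin_def twin'_def algebra_simps)
qed simp

lemma twins_total:
  fixes g :: "nat \<Rightarrow> real"
  assumes "\<And>c. c < m \<Longrightarrow> 1 \<le> g (twin e c) + g (twin' e c)"
  shows "m \<le> (\<Sum>c<m. g (twin e c) + g (twin' e c))"
  using sum_mono[of "{..<m}" "\<lambda>_. 1 :: real"] assms by fastforce

lemma dim_f_coded_ge: "m \<le> dim_f (coded m e clique)"
proof -
  obtain g where g: "resolving_function (coded m e clique) g"
    "sum g {..4 * m} = dim_f (coded m e clique)"
    using dim_f_minimum(1)[of "coded m e clique"] by auto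
  have nonneg: "g v \<ge> 0" if "v \<le> 4 * m" for v
    using g(1) that by (simp add: resolving_function_def)
  have "(\<Sum>c<m. g (twin (\<not> e) c) + g (twin' (\<not> e) c)) \<ge> 0"
    using twin_le[of _ m "\<not> e"] by (force intro!: sum_nonneg add_nonneg_nonneg nonneg)
  moreover have "m \<le> (\<Sum>c<m. g (twin e c) + g (twin' e c))"
    using twins_weight[OF g(1)] by (rule twins_total)
  ultimately show ?thesis
    using nonneg[of 0] g(2) by (simp add: sum_twins[of _ _ e])
qed

definition side_weight :: "bool \<Rightarrow> nat \<Rightarrow> real" where
  "side_weight e v = (if v = 0 then 1 else if even v = e then 1 / 2 else 0)"

lemma sum_side_weight: "sum (side_weight e) {..4 * m} = m + 1"
proof -
  have "side_weight e (twin e c) + side_weight e (twin' e c) = 1"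
    "side_weight e (twin (\<not> e) c) + side_weight e (twin' (\<not> e) c) = 0" for c
    by (auto simp: side_weight_def)
  then show ?thesis
    by (simp add: sum_twins[of "side_weight e" m e] side_weight_def[of e 0])
qed

text \<open>
  The bound \<open>m \<ge> 6\<close> makes \<open>m - 1\<close> binary digits sufficient for the numbers up to \<open>4m\<close>.  Thus the
  \<open>m\<close> pairs tell the coded vertices apart, and no coded vertex is joined to the last pair, which
  therefore separates them from the clique of twins.  The unit weight on \<open>0\<close> takes care of the
  pairs that contain \<open>0\<close>.
\<close>

lemma resolving_side_weight:
  assumes "m \<ge> 6"
  shows "resolving_function (coded m e clique) (side_weight e)"
proof -
  let ?G = "coded m e clique" and ?g = "side_weight e"
  have "4 * m < 2 ^ (m - 1)"
    using assms
  proof (induction m rule: dec_induct)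
    case (step n)
    then have "2 ^ (Suc n - 1) = 2 * (2 :: nat) ^ (n - 1)"
      by (simp flip: power_Suc)
    then show ?case
      using step by simp
  qed simp
  then have small: "v < 2 ^ (m - 1)" if "v \<le> 4 * m" for v
    using that by linarith
  have digit: "\<not> bit v i" if "v \<le> 4 * m" "i \<ge> m - 1" for v i
  proof -
    have "v < 2 ^ i"
      using small[OF that(1)] power_increasing[OF that(2), of "2 :: nat"] by linarith
    then show ?thesis
      by (simp add: bit_iff_odd)
  qed
  have heavy: "1 \<le> sum ?g (resolving_nbhd ?G x y)"
    if "T \<subseteq> resolving_nbhd ?G x y" "sum ?g T \<ge> 1" for x y T
  proof -
    have "sum ?g T \<le> sum ?g (resolving_nbhd ?G x y)"
      using that(1) by (intro sum_mono2) (auto simp: resolving_nbhd_def side_weight_def)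
    then show ?thesis
      using that(2) by linarith
  qed
  have pair: "sum ?g {twin e c, twin' e c} = 1" for c
    by (simp add: side_weight_def)
  have mixed: "1 \<le> sum ?g (resolving_nbhd ?G x y)"
    if "x \<le> 4 * m" "y \<le> 4 * m" "even x = e" "even y \<noteq> e" "x \<noteq> 0" "y \<noteq> 0" for x y
  proof (rule heavy[OF _ eq_refl[OF pair[of "m - 1", symmetric]]])
    have "twin' e (m - 1) \<le> 4 * m" "twin e (m - 1) \<le> 4 * m"
      using twin_le[of "m - 1" m e] assms by auto
    moreover have "x \<noteq> y"
      using that by blast
    ultimately show "{twin e (m - 1), twin' e (m - 1)} \<subseteq> resolving_nbhd ?G x y"
      using that digit[of y "m - 1"]
      by (auto simp: mem_resolving_nbhd_coded arc_coded)
  qed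
  have sym: "resolving_nbhd ?G x y = resolving_nbhd ?G y x" for x y
    by (auto simp: resolving_nbhd_def)
  have "1 \<le> sum ?g (resolving_nbhd ?G x y)" if xy: "x \<le> 4 * m" "y \<le> 4 * m" "x \<noteq> y" for x y
  proof -
    consider "x = 0 \<or> y = 0" | "x \<noteq> 0" "y \<noteq> 0" "even x = e" "even y = e"
      | "x \<noteq> 0" "y \<noteq> 0" "even x = e" "even y \<noteq> e" | "x \<noteq> 0" "y \<noteq> 0" "even x \<noteq> e" "even y = e"
      | "x \<noteq> 0" "y \<noteq> 0" "even x \<noteq> e" "even y \<noteq> e"
      by blast
    then show ?thesis
    proof cases
      case 1
      then show ?thesis
        using xy by (intro heavy[of "{0}"]) (auto simp: mem_resolving_nbhd_coded side_weight_def)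
    next
      case 2
      then show ?thesis
        using xy
        by (intro heavy[of "{x, y}"]) (auto simp: mem_resolving_nbhd_coded side_weight_def)
    next
      case 3
      then show ?thesis
        using mixed xy by blast
    next
      case 4
      then show ?thesis
        using mixed[of y x] xy sym by simp
    next
      case 5
      obtain c where c: "bit x c \<noteq> bit y c"
        using xy(3) bit_eqI by blast
      then have "c < m"
        using digit[OF xy(1), of c] digit[OF xy(2), of c] by (cases "c < m") auto
      then have "twin' e c \<le> 4 * m" "twin e c \<le> 4 * m"
        using twin_le[of c m e] by auto
      then have "{twin e c, twin' e c} \<subseteq> resolving_nbhd ?G x y"
        using xy 5 c by (auto simp: mem_resolving_nbhd_coded arc_coded)
      then show ?thesis
        by (rule heavy[OF _ eq_refl[OF pair[of c, symmetric]]])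
    qed
  qed
  then show ?thesis
    by (auto simp: resolving_function_def side_weight_def)
qed

lemma dim_f_coded_le:
  assumes "m \<ge> 6"
  shows "dim_f (coded m e clique) \<le> m + 1"
  using dim_f_minimum(2)[OF _ resolving_side_weight[OF assms, of e clique]]
  by (simp add: sum_side_weight)

section \<open>The three families\<close>

lemma coded_sides_neq:
  assumes "m \<ge> 6"
  shows "coded m True False \<noteq> coded m False False"
proof
  assume eq: "coded m True False = coded m False False"
  have "(2, 4) \<in> parcs (coded m True False)" "(2, 4) \<notin> parcs (coded m False False)"
    using assms by (auto simp: coded_def parcs_cone)
  then show False
    by (simp add: eq)
qed

lemma coded_cliques_neq:
  assumes "m \<ge> 6"
  shows "coded m True False \<noteq> coded m True True"
proof
  assume eq: "coded m True False = coded m True True"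
  have "(1, 3) \<in> parcs (coded m True True)" "(1, 3) \<notin> parcs (coded m True False)"
    using assms by (auto simp: coded_def parcs_cone)
  then show False
    by (simp add: eq)
qed

lemma graph_family_coded:
  assumes "G = coded m e b" "H = coded m e' b'" "G \<noteq> H" "m \<ge> 6"
  shows "graph_family {..4 * m} {G, H}"
  using assms by (intro graph_family_cones) (auto simp: coded_def)

lemma Sd_f_both_sides:
  "2 * m \<le> Sd_f {..4 * m} {coded m True False, coded m False False}"
proof -
  have pverts: "pverts G = {..4 * m}" if "G \<in> {coded m True False, coded m False False}" for G
    using that by auto
  obtain g where g: "sim_resolving_function {..4 * m} {coded m True False, coded m False False} g"
    "sum g {..4 * m} = Sd_f {..4 * m} {coded m True False, coded m False False}"
    using Sd_f_minimum(1)[OF finite_atMost pverts] by blast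
  have "m \<le> (\<Sum>c<m. g (twin e c) + g (twin' e c))" for e
    using g(1) by (cases e; intro twins_total twins_weight[where clique = False])
      (auto simp: sim_resolving_function_def)
  note this[of True] this[of False]
  moreover have "g 0 \<ge> 0"
    using g(1) by (simp add: sim_resolving_function_def)
  ultimately show ?thesis
    using g(2) by (simp add: sum_twins[of _ _ True])
qed

lemma Sd_f_same_side:
  assumes "m \<ge> 6"
  shows "Sd_f {..4 * m} {coded m True False, coded m True True} \<le> m + 1"
proof -
  have "sim_resolving_function {..4 * m} {coded m True False, coded m True True} (side_weight True)"
    using resolving_side_weight[OF assms]
    by (auto simp: sim_resolving_function_def side_weight_def)
  then have "Sd_f {..4 * m} {coded m True False, coded m True True}
      \<le> sum (side_weight True) {..4 * m}"
    by (intro Sd_f_minimum(2)) auto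
  then show ?thesis
    by (simp add: sum_side_weight)
qed

text \<open>Both \<open>x\<close> and \<open>y\<close> resolve the pair \<open>x, y\<close>, so half a unit on every vertex is enough.\<close>

lemma Sd_f_le_half_card:
  assumes "finite V" "\<And>G. G \<in> \<G> \<Longrightarrow> pverts G = V"
  shows "Sd_f V \<G> \<le> card V / 2"
proof -
  have "1 \<le> sum (\<lambda>_. 1 / 2 :: real) (resolving_nbhd G x y)"
    if "G \<in> \<G>" "x \<in> V" "y \<in> V" "x \<noteq> y" for G x y
  proof -
    have "{x, y} \<subseteq> resolving_nbhd G x y"
      using mem_resolving_nbhd[of x G y] mem_resolving_nbhd[of y G x] that assms(2)
      by (auto simp: resolving_nbhd_def)
    moreover have "finite (resolving_nbhd G x y)"
      using assms that by (simp add: resolving_nbhd_def)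
    ultimately have "card {x, y} \<le> card (resolving_nbhd G x y)"
      by (intro card_mono)
    then show ?thesis
      using that by simp
  qed
  then have "sim_resolving_function V \<G> (\<lambda>_. 1 / 2)"
    using assms(2) by (auto simp: sim_resolving_function_def resolving_function_def)
  from Sd_f_minimum(2)[OF assms this] show ?thesis
    by simp
qed

abbreviation complete_graph :: "nat \<Rightarrow> nat pair_pre_digraph" where
  "complete_graph n \<equiv> cone_graph n (\<lambda>_ _. True)"

abbreviation star_graph :: "nat \<Rightarrow> nat pair_pre_digraph" where
  "star_graph n \<equiv> cone_graph n (\<lambda>_ _. False)"

text \<open>Two vertices of a complete graph are resolved only by themselves, so at most one is omitted.\<close>

lemma resolving_set_complete:
  assumes "resolving_set (complete_graph n) S"
  shows "n \<le> card S"
proof (rule ccontr)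
  assume "\<not> n \<le> card S"
  have S: "S \<subseteq> {..n}"
    using assms by (simp add: resolving_set_def)
  then have "card ({..n} - S) = Suc n - card S"
    by (simp add: card_Diff_subset finite_subset)
  then have "\<not> card ({..n} - S) \<le> Suc 0"
    using \<open>\<not> n \<le> card S\<close> by simp
  then obtain x y where xy: "x \<in> {..n} - S" "y \<in> {..n} - S" "x \<noteq> y"
    by (subst (asm) card_le_Suc0_iff_eq) auto
  then have "S \<inter> resolving_nbhd (complete_graph n) x y \<noteq> {}"
    using assms by (simp add: resolving_set_def)
  then show False
    using xy by (auto simp: mem_resolving_nbhd_cone parcs_cone)
qed

lemma Sd_complete:
  assumes "complete_graph n \<in> \<G>" "\<And>G. G \<in> \<G> \<Longrightarrow> pverts G = {..n}"
  shows "n \<le> Sd {..n} \<G>"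
proof -
  let ?\<S> = "{S. S \<subseteq> {..n} \<and> (\<forall>G \<in> \<G>. resolving_set G S)}"
  have "resolving_set G {..n}" if "G \<in> \<G>" for G
    using mem_resolving_nbhd[of _ G] assms(2)[OF that] by (fastforce simp: resolving_set_def)
  then have "?\<S> \<noteq> {}"
    by blast
  moreover have "finite ?\<S>"
    by (rule finite_subset[of _ "Pow {..n}"]) auto
  moreover have "n \<le> card S" if "S \<in> ?\<S>" for S
    using that assms(1) resolving_set_complete by blast
  ultimately show ?thesis
    unfolding Sd_def by (subst Min_ge_iff) auto
qed

lemma complete_neq_star:
  assumes "n \<ge> 2"
  shows "complete_graph n \<noteq> star_graph n"
proof
  assume eq: "complete_graph n = star_graph n"
  have "(1, 2) \<in> parcs (complete_graph n)" "(1, 2) \<notin> parcs (star_graph n)"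
    using assms by (auto simp: parcs_cone)
  then show False
    by (simp add: eq)
qed

theorem mainTheorem5:
  shows "(\<forall>N :: real. \<exists>(V :: nat set) \<G>. graph_family V \<G> \<and>
            Sd_f V \<G> - Max (dim_f ` \<G>) \<ge> N) \<and>
         (\<forall>N :: real. \<exists>(V :: nat set) \<G>. graph_family V \<G> \<and>
            min (\<Sum>G\<in>\<G>. dim_f G) (real (card V) / 2) - Sd_f V \<G> \<ge> N) \<and>
         (\<forall>N :: real. \<exists>(V :: nat set) \<G>. graph_family V \<G> \<and>
            real (Sd V \<G>) - Sd_f V \<G> \<ge> N)"
proof (intro conjI allI)
  fix N :: real
  obtain k :: nat where k: "N \<le> k"
    using real_arch_simple by blast
  define m where "m = k + 6"
  have m: "m \<ge> 6" "N \<le> real m - 1"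
    using k by (auto simp: m_def)
  show "\<exists>(V :: nat set) \<G>. graph_family V \<G> \<and> Sd_f V \<G> - Max (dim_f ` \<G>) \<ge> N"
  proof (intro exI conjI)
    let ?\<G> = "{coded m True False, coded m False False}"
    show "graph_family {..4 * m} ?\<G>"
      by (rule graph_family_coded[OF refl refl coded_sides_neq[OF m(1)] m(1)])
    have "Max (dim_f ` ?\<G>) \<le> m + 1"
      using dim_f_coded_le[OF m(1)] by (subst Max_le_iff) auto
    then show "Sd_f {..4 * m} ?\<G> - Max (dim_f ` ?\<G>) \<ge> N"
      using Sd_f_both_sides[of m] m(2) by linarith
  qed
  show "\<exists>(V :: nat set) \<G>. graph_family V \<G> \<and>
      min (\<Sum>G\<in>\<G>. dim_f G) (real (card V) / 2) - Sd_f V \<G> \<ge> N"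
  proof (intro exI conjI)
    let ?\<G> = "{coded m True False, coded m True True}"
    show "graph_family {..4 * m} ?\<G>"
      by (rule graph_family_coded[OF refl refl coded_cliques_neq[OF m(1)] m(1)])
    have "(\<Sum>G\<in>?\<G>. dim_f G) \<ge> 2 * m"
      using dim_f_coded_ge[of m True False] dim_f_coded_ge[of m True True]
        coded_cliques_neq[OF m(1)] by simp
    moreover have "real (card {..4 * m}) / 2 \<ge> 2 * m"
      by simp
    ultimately show "min (\<Sum>G\<in>?\<G>. dim_f G) (real (card {..4 * m}) / 2) - Sd_f {..4 * m} ?\<G> \<ge> N"
      using Sd_f_same_side[OF m(1)] m(2) by linarith
  qed
  show "\<exists>(V :: nat set) \<G>. graph_family V \<G> \<and> real (Sd V \<G>) - Sd_f V \<G> \<ge> N"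
  proof (intro exI conjI)
    let ?n = "2 * m" and ?\<G> = "{complete_graph (2 * m), star_graph (2 * m)}"
    show "graph_family {..?n} ?\<G>"
      using complete_neq_star[of ?n] m(1) by (intro graph_family_cones) auto
    have "?n \<le> Sd {..?n} ?\<G>"
      by (rule Sd_complete) auto
    moreover have "Sd_f {..?n} ?\<G> \<le> card {..?n} / 2"
      by (rule Sd_f_le_half_card) auto
    ultimately show "real (Sd {..?n} ?\<G>) - Sd_f {..?n} ?\<G> \<ge> N"
      using m(2) by simp
  qed
qed

end
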